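(* Let $R$ be a standard graded $K$-algebra over a field $K$ with $\operatorname{depth}(R)>0$, and let $d$ be a positive integer. Then $\mathfrak m^{(d)}\subseteq \operatorname{tr}_{R^{(d)}}(M_j)$ for any $d$-th Veronese submodule $M_j$ of $R$, $0\le j\le d-1$.
   Context: A standard graded $K$-algebra is a finitely generated $\mathbb{N}$-graded commutative $K$-algebra $R=\bigoplus_{i\geq 0}R_i$ with $R_0=K$ that is generated over $K$ by $R_1$; $\operatorname{depth}(R)$ is the grade of its graded maximal ideal $\bigoplus_{i>0}R_i$ on $R$. The $d$-th Veronese subring of $R$ is $R^{(d)}=\bigoplus_{i\ge 0}R_{id}$, viewed as a standard graded $K$-algebra by giving the elements of $R_d$ degree $1$; $\mathfrak m^{(d)}$ denotes its graded maximal ideal $\bigoplus_{i>0}R_{id}$. The $d$-th Veronese submodules of $R$ are the $R^{(d)}$-modules $M_j=\bigoplus_{i\in\mathbb N}R_{di+j}$ for $j=0,\dots,d-1$. For a module $M$ over a ring $A$, $\operatorname{tr}_A(M)=\sum_{\varphi\in\operatorname{Hom}_A(M,A)}\varphi(M)$. *)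

theory Defs
  imports "HOL-Algebra.Algebra" "HOL-Library.Extended_Nat"
begin

text \<open>For a grading \<open>G\<close> this sum is direct, so it is the subgroup \<open>\<Oplus>i\<in>I. G i\<close> of \<open>R\<close>.\<close>

definition homogeneous_sum :: "('a, 'm) ring_scheme \<Rightarrow> (nat \<Rightarrow> 'a set) \<Rightarrow> nat set \<Rightarrow> 'a set"
  where "homogeneous_sum R G I =
    {(\<Oplus>\<^bsub>R\<^esub>i\<in>F. c i) | F c. finite F \<and> F \<subseteq> I \<and> c \<in> (\<Pi> i\<in>F. G i)}"

locale graded_cring = cring R
  for R :: "('a, 'm) ring_scheme" (structure) and G :: "nat \<Rightarrow> 'a set" +
  assumes component_subgroup: "additive_subgroup (G i) R"
    and component_mult: "\<lbrakk> x \<in> G i; y \<in> G j \<rbrakk> \<Longrightarrow> x \<otimes> y \<in> G (i + j)"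
    and direct_sum: "x \<in> carrier R \<Longrightarrow>
      \<exists>!c. (\<forall>i. c i \<in> G i) \<and> finite {i. c i \<noteq> \<zero>} \<and> x = (\<Oplus>i\<in>{i. c i \<noteq> \<zero>}. c i)"

text \<open>Since the degree \<open>0\<close> part is required to equal the base field, the field \<open>K\<close> is a subfield
  of \<open>R\<close>, and the \<open>K\<close>-subalgebra generated by \<open>S\<close> is the subring generated by \<open>K \<union> S\<close>.\<close>

locale standard_graded_algebra = graded_cring R G + subfield K R
  for K and R :: "('a, 'm) ring_scheme" (structure) and G +
  assumes component_zero: "G 0 = K"
    and finitely_generated:
      "\<exists>S. finite S \<and> S \<subseteq> carrier R \<and> generate_ring R (K \<union> S) = carrier R"
    and generated_in_degree_one: "generate_ring R (K \<union> G 1) = carrier R"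

definition graded_maximal_ideal :: "('a, 'm) ring_scheme \<Rightarrow> (nat \<Rightarrow> 'a set) \<Rightarrow> 'a set"
  where "graded_maximal_ideal R G = homogeneous_sum R G {0<..}"

definition nonzerodivisor :: "('a, 'm) ring_scheme \<Rightarrow> 'a \<Rightarrow> bool"
  where "nonzerodivisor A x \<longleftrightarrow> x \<in> carrier A \<and>
    (\<forall>r\<in>carrier A. x \<otimes>\<^bsub>A\<^esub> r = \<zero>\<^bsub>A\<^esub> \<longrightarrow> r = \<zero>\<^bsub>A\<^esub>)"

definition regular_sequence :: "('a, 'm) ring_scheme \<Rightarrow> 'a list \<Rightarrow> bool"
  where "regular_sequence A xs \<longleftrightarrow> set xs \<subseteq> carrier A \<and>
    (\<forall>i<length xs. let J = genideal A (set (take i xs))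
       in nonzerodivisor (A Quot J) (J +>\<^bsub>A\<^esub> (xs ! i))) \<and>
    genideal A (set xs) \<noteq> carrier A"

definition grade :: "('a, 'm) ring_scheme \<Rightarrow> 'a set \<Rightarrow> enat"
  where "grade A I = Sup {enat (length xs) | xs. set xs \<subseteq> I \<and> regular_sequence A xs}"

definition depth :: "('a, 'm) ring_scheme \<Rightarrow> (nat \<Rightarrow> 'a set) \<Rightarrow> enat"
  where "depth R G = grade R (graded_maximal_ideal R G)"

definition regular_module :: "('a, 'm) ring_scheme \<Rightarrow> ('a, 'a) module"
  where "regular_module A = \<lparr>carrier = carrier A, monoid.mult = monoid.mult A, monoid.one = monoid.one A,
    ring.zero = ring.zero A, ring.add = ring.add A, smult = monoid.mult A\<rparr>"

definition module_homs ::
  "('a, 'm) ring_scheme \<Rightarrow> ('a, 'b, 'n) module_scheme \<Rightarrow> ('a, 'c, 'p) module_scheme \<Rightarrow> ('b \<Rightarrow> 'c) set"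
  where "module_homs A M N = {\<phi> \<in> carrier M \<rightarrow> carrier N.
    (\<forall>x\<in>carrier M. \<forall>y\<in>carrier M. \<phi> (x \<oplus>\<^bsub>M\<^esub> y) = \<phi> x \<oplus>\<^bsub>N\<^esub> \<phi> y) \<and>
    (\<forall>a\<in>carrier A. \<forall>x\<in>carrier M. \<phi> (a \<odot>\<^bsub>M\<^esub> x) = a \<odot>\<^bsub>N\<^esub> \<phi> x)}"

text \<open>Homomorphisms are only constrained on the carrier; their values elsewhere play no role.
  An element of the sum of the images \<open>\<phi>(M)\<close> is a finite sum with one summand
  \<open>\<phi> (x \<phi>)\<close> from each of finitely many of the images.\<close>

definition module_trace :: "('a, 'm) ring_scheme \<Rightarrow> ('a, 'b, 'n) module_scheme \<Rightarrow> 'a set"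
  where "module_trace A M = {(\<Oplus>\<^bsub>A\<^esub>\<phi>\<in>F. \<phi> (x \<phi>)) | F x.
    finite F \<and> F \<subseteq> module_homs A M (regular_module A) \<and> x \<in> F \<rightarrow> carrier M}"

definition veronese_grading :: "(nat \<Rightarrow> 'a set) \<Rightarrow> nat \<Rightarrow> nat \<Rightarrow> 'a set"
  where "veronese_grading G d = (\<lambda>i. G (i * d))"

definition veronese_ring :: "('a, 'm) ring_scheme \<Rightarrow> (nat \<Rightarrow> 'a set) \<Rightarrow> nat \<Rightarrow> ('a, 'm) ring_scheme"
  where "veronese_ring R G d = R\<lparr>carrier := homogeneous_sum R (veronese_grading G d) UNIV\<rparr>"

definition veronese_submodule ::
  "('a, 'm) ring_scheme \<Rightarrow> (nat \<Rightarrow> 'a set) \<Rightarrow> nat \<Rightarrow> nat \<Rightarrow> ('a, 'a) module"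
  where "veronese_submodule R G d j =
    (regular_module R)\<lparr>carrier := homogeneous_sum R (\<lambda>i. G (d * i + j)) UNIV\<rparr>"

context graded_cring
begin

lemma homogeneous_sum_add:
  assumes H: "\<And>i. additive_subgroup (H i) R"
    and x: "x \<in> homogeneous_sum R H I" and y: "y \<in> homogeneous_sum R H I"
  shows "x \<oplus> y \<in> homogeneous_sum R H I"
proof -
  have Hc: "z \<in> H i \<Longrightarrow> z \<in> carrier R" for z i
    using additive_subgroup.a_subset[OF H] by blast
  have Hz: "\<zero> \<in> H i" for i by (rule additive_subgroup.zero_closed[OF H])
  obtain F c where c: "finite F" "F \<subseteq> I" "c \<in> (\<Pi> i\<in>F. H i)" "x = (\<Oplus>i\<in>F. c i)"
    using x unfolding homogeneous_sum_def by blast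
  obtain F' c' where c': "finite F'" "F' \<subseteq> I" "c' \<in> (\<Pi> i\<in>F'. H i)" "y = (\<Oplus>i\<in>F'. c' i)"
    using y unfolding homogeneous_sum_def by blast
  have ext: "(\<Oplus>i\<in>A. f i) = (\<Oplus>i\<in>A \<union> B. if i \<in> A then f i else \<zero>)"
    if "finite A" "finite B" "f \<in> (\<Pi> i\<in>A. H i)" for A B f
    by (rule add.finprod_mono_neutral_cong_left) (use that Hc in \<open>auto simp: Pi_iff\<close>)
  let ?e = "\<lambda>i. if i \<in> F then c i else \<zero>" and ?e' = "\<lambda>i. if i \<in> F' then c' i else \<zero>"
  have e: "?e i \<in> H i" "?e' i \<in> H i" for i
    using c(3) c'(3) Hz by (auto simp: Pi_iff)
  have "x \<oplus> y = (\<Oplus>i\<in>F \<union> F'. ?e i) \<oplus> (\<Oplus>i\<in>F \<union> F'. ?e' i)"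
    using ext[OF c(1) c'(1) c(3)] ext[OF c'(1) c(1) c'(3)] c(4) c'(4) by (simp add: Un_commute)
  also have "\<dots> = (\<Oplus>i\<in>F \<union> F'. ?e i \<oplus> ?e' i)"
    by (rule finsum_addf[symmetric]) (use Hc e in blast)+
  finally have "x \<oplus> y = (\<Oplus>i\<in>F \<union> F'. ?e i \<oplus> ?e' i)" .
  moreover have "(\<lambda>i. ?e i \<oplus> ?e' i) \<in> (\<Pi> i\<in>F \<union> F'. H i)"
    using additive_subgroup.a_closed[OF H e] by blast
  moreover have "finite (F \<union> F')" "F \<union> F' \<subseteq> I"
    using c(1,2) c'(1,2) by auto
  ultimately show ?thesis
    unfolding homogeneous_sum_def by blast
qed

lemma homogeneous_sum_subgroup:
  assumes H: "\<And>i. additive_subgroup (H i) R"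
  shows "additive_subgroup (homogeneous_sum R H I) R"
proof -
  have Hc: "z \<in> H i \<Longrightarrow> z \<in> carrier R" for z i
    using additive_subgroup.a_subset[OF H] by blast
  have neg: "\<ominus> (\<Oplus>i\<in>F. c i) = (\<Oplus>i\<in>F. \<ominus> c i)" if "finite F" "c \<in> (\<Pi> i\<in>F. H i)" for F c
  proof -
    have "(\<Oplus>i\<in>F. \<ominus> c i) = (\<Oplus>i\<in>F. (\<ominus> \<one>) \<otimes> c i)"
      by (rule finsum_cong') (use that Hc in \<open>auto simp: l_minus Pi_iff\<close>)
    also have "\<dots> = (\<ominus> \<one>) \<otimes> (\<Oplus>i\<in>F. c i)"
      by (rule finsum_rdistr[symmetric]) (use that Hc in \<open>auto simp: Pi_iff\<close>)
    also have "\<dots> = \<ominus> (\<Oplus>i\<in>F. c i)"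
    proof -
      have "(\<Oplus>i\<in>F. c i) \<in> carrier R"
        using Hc that by (auto simp: Pi_iff intro!: finsum_closed)
      then show ?thesis by (simp add: l_minus)
    qed
    finally show ?thesis ..
  qed
  show ?thesis
  proof (rule additive_subgroup.intro, rule add.subgroupI)
    show "homogeneous_sum R H I \<subseteq> carrier R"
      unfolding homogeneous_sum_def using Hc by (auto simp: Pi_iff intro!: finsum_closed)
    have "\<zero> \<in> homogeneous_sum R H I"
      unfolding homogeneous_sum_def by (auto intro!: exI[of _ "{}"])
    then show "homogeneous_sum R H I \<noteq> {}" by blast
    fix x assume "x \<in> homogeneous_sum R H I"
    then obtain F c where c: "finite F" "F \<subseteq> I" "c \<in> (\<Pi> i\<in>F. H i)" "x = (\<Oplus>i\<in>F. c i)"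
      unfolding homogeneous_sum_def by blast
    then have "\<ominus> x = (\<Oplus>i\<in>F. \<ominus> c i) \<and> (\<lambda>i. \<ominus> c i) \<in> (\<Pi> i\<in>F. H i)"
      using neg additive_subgroup.a_inv_closed[OF H] is_abelian_group by (auto simp: Pi_iff)
    then show "\<ominus> x \<in> homogeneous_sum R H I"
      unfolding homogeneous_sum_def using c(1,2) by blast
  next
    fix x y assume "x \<in> homogeneous_sum R H I" "y \<in> homogeneous_sum R H I"
    then show "x \<oplus> y \<in> homogeneous_sum R H I"
      by (rule homogeneous_sum_add[OF H])
  qed
qed

lemma homogeneous_sum_mult:
  assumes H: "\<And>i. additive_subgroup (H i) R" and H': "\<And>i. additive_subgroup (H' i) R"
    and H'': "\<And>i. additive_subgroup (H'' i) R"
    and HH': "\<And>i j x y. x \<in> H i \<Longrightarrow> y \<in> H' j \<Longrightarrow> x \<otimes> y \<in> H'' (i + j)"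
    and x: "x \<in> homogeneous_sum R H UNIV" and y: "y \<in> homogeneous_sum R H' UNIV"
  shows "x \<otimes> y \<in> homogeneous_sum R H'' UNIV"
proof -
  have Hc: "z \<in> H i \<Longrightarrow> z \<in> carrier R" and Hc': "z \<in> H' i \<Longrightarrow> z \<in> carrier R" for z i
    using additive_subgroup.a_subset[OF H] additive_subgroup.a_subset[OF H'] by blast+
  interpret S: additive_subgroup "homogeneous_sum R H'' UNIV" R
    by (rule homogeneous_sum_subgroup[OF H''])
  have hom: "z \<in> homogeneous_sum R H'' UNIV" if "z \<in> H'' i" for z i
  proof -
    have "z \<in> carrier R" using that additive_subgroup.a_subset[OF H''] by blast
    then have "z = (\<Oplus>k\<in>{i}. z)" by simp
    moreover have "(\<lambda>_. z) \<in> (\<Pi> k\<in>{i}. H'' k)" using that by simp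
    ultimately show ?thesis unfolding homogeneous_sum_def by blast
  qed
  have sums: "(\<Oplus>i\<in>F. f i) \<in> homogeneous_sum R H'' UNIV"
    if "finite F" "\<And>i. i \<in> F \<Longrightarrow> f i \<in> homogeneous_sum R H'' UNIV" for F :: "nat set" and f
    using that
  proof (induction F)
    case empty
    then show ?case using S.zero_closed by simp
  next
    case (insert i F)
    have "f \<in> F \<rightarrow> carrier R" "f i \<in> carrier R"
      using insert.prems S.a_subset by (auto simp: Pi_iff)
    then show ?case using insert S.a_closed by (simp add: finsum_insert)
  qed
  obtain F c where c: "finite F" "c \<in> (\<Pi> i\<in>F. H i)" "x = (\<Oplus>i\<in>F. c i)"
    using x unfolding homogeneous_sum_def by blast
  obtain F' c' where c': "finite F'" "c' \<in> (\<Pi> i\<in>F'. H' i)" "y = (\<Oplus>i\<in>F'. c' i)"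
    using y unfolding homogeneous_sum_def by blast
  have yc: "y \<in> carrier R" using c' Hc' by (auto simp: Pi_iff intro!: finsum_closed)
  have "x \<otimes> y = (\<Oplus>i\<in>F. c i \<otimes> y)"
    unfolding c(3) by (rule finsum_ldistr) (use c yc Hc in \<open>auto simp: Pi_iff\<close>)
  moreover have "c i \<otimes> y \<in> homogeneous_sum R H'' UNIV" if "i \<in> F" for i
  proof -
    have "c i \<otimes> y = (\<Oplus>k\<in>F'. c i \<otimes> c' k)"
      unfolding c'(3) by (rule finsum_rdistr) (use c c' that Hc Hc' in \<open>auto simp: Pi_iff\<close>)
    moreover have "\<dots> \<in> homogeneous_sum R H'' UNIV"
      by (rule sums[OF c'(1)], rule hom[OF HH']) (use c c' that in \<open>auto simp: Pi_iff\<close>)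
    ultimately show ?thesis by simp
  qed
  ultimately show ?thesis using sums[OF c(1)] by simp
qed

lemma veronese_ring_mult_closed:
  "\<lbrakk> x \<in> homogeneous_sum R (veronese_grading G d) UNIV;
     y \<in> homogeneous_sum R (\<lambda>i. G (d * i + j)) UNIV \<rbrakk>
   \<Longrightarrow> x \<otimes> y \<in> homogeneous_sum R (\<lambda>i. G (d * i + j)) UNIV"
proof (rule homogeneous_sum_mult[of "veronese_grading G d" "\<lambda>i. G (d * i + j)"])
  fix i k x y assume "x \<in> veronese_grading G d i" "y \<in> G (d * k + j)"
  then have "x \<otimes> y \<in> G (i * d + (d * k + j))"
    unfolding veronese_grading_def by (rule component_mult)
  then show "x \<otimes> y \<in> G (d * (i + k) + j)" by (simp add: algebra_simps)
qed (simp_all add: component_subgroup veronese_grading_def)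

end

context standard_graded_algebra
begin

lemma veronese_subcring: "subcring (homogeneous_sum R (veronese_grading G d) UNIV) R"
proof -
  let ?S = "homogeneous_sum R (veronese_grading G d) UNIV"
  have eq: "veronese_grading G d = (\<lambda>i. G (d * i + 0))"
    by (simp add: veronese_grading_def mult.commute)
  interpret S: additive_subgroup ?S R
    by (rule homogeneous_sum_subgroup) (simp add: veronese_grading_def component_subgroup)
  have "\<one> \<in> G 0" using component_zero by simp
  then have "(\<lambda>_. \<one>) \<in> (\<Pi> i\<in>{0}. veronese_grading G d i)" by (simp add: veronese_grading_def)
  moreover have "\<one> = (\<Oplus>i\<in>{0 :: nat}. \<one>)" by simp
  ultimately have one: "\<one> \<in> ?S" unfolding homogeneous_sum_def by blast
  have "subring ?S R"
  proof (rule subringI)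
    show "x \<otimes> y \<in> ?S" if "x \<in> ?S" "y \<in> ?S" for x y
      using veronese_ring_mult_closed[of x d y 0] that eq by simp
  qed (use one S.a_subset S.a_closed S.a_inv_closed is_abelian_group in auto)
  then show ?thesis
    by (rule subcringI) (use S.a_subset m_comm in blast)
qed

lemma veronese_ring_cring: "cring (veronese_ring R G d)"
  unfolding veronese_ring_def
  using veronese_subcring subcring_iff[OF subringE(1)[OF subcring.axioms(1)[OF veronese_subcring]]]
  by simp

lemma veronese_submodule_module:
  "module (veronese_ring R G d) (veronese_submodule R G d j)"
proof -
  let ?S = "homogeneous_sum R (veronese_grading G d) UNIV"
  let ?M = "homogeneous_sum R (\<lambda>i. G (d * i + j)) UNIV"
  interpret M: additive_subgroup ?M R
    by (rule homogeneous_sum_subgroup) (rule component_subgroup)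
  have S: "x \<in> ?S \<Longrightarrow> x \<in> carrier R" for x
    using subringE(1)[OF subcring.axioms(1)[OF veronese_subcring]] by blast
  have M: "x \<in> ?M \<Longrightarrow> x \<in> carrier R" for x using M.a_subset by blast
  show ?thesis
  proof (rule moduleI)
    show "cring (veronese_ring R G d)" by (rule veronese_ring_cring)
    show "abelian_group (veronese_submodule R G d j)"
    proof (rule abelian_groupI)
      fix x assume "x \<in> carrier (veronese_submodule R G d j)"
      then show "\<exists>y\<in>carrier (veronese_submodule R G d j).
          y \<oplus>\<^bsub>veronese_submodule R G d j\<^esub> x = \<zero>\<^bsub>veronese_submodule R G d j\<^esub>"
        using M l_neg
        by (auto simp: veronese_submodule_def regular_module_def intro!: bexI[OF _ M.a_inv_closed])
    qed (auto simp: veronese_submodule_def regular_module_def M a_assoc intro: a_comm)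
  qed (auto simp: veronese_submodule_def regular_module_def veronese_ring_def
      S M l_distr r_distr m_assoc veronese_ring_mult_closed)
qed

end

end

theory Submission
  imports Defs
begin

text \<open>Multiplication by an element of \<open>R\<^bsub>d-j\<^esub>\<close> is a homomorphism from \<open>M\<^bsub>j\<^esub>\<close> to the Veronese
  ring, so the trace contains \<open>R\<^bsub>d-j\<^esub> R\<^bsub>di+j\<^esub>\<close> for every \<open>i\<close>. Since \<open>R\<close> is generated in degree
  one, these products span \<open>R\<^bsub>d(i+1)\<^esub>\<close>.\<close>

section \<open>Sums in additive subgroups, and the trace as an additive subgroup\<close>

lemma (in abelian_group) additive_subgroup_finsum_closed:
  assumes "additive_subgroup H G" and "f \<in> F \<rightarrow> H"
  shows "(\<Oplus>i\<in>F. f i) \<in> H"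
proof -
  interpret H: additive_subgroup H G by fact
  show ?thesis
    using assms(2)
  \<comment> \<open>A sum over an infinite index set is \<open>\<zero>\<close> by convention, which
    lies in every additive subgroup.\<close>
  proof (induction F rule: infinite_finite_induct)
    case (insert i F)
    moreover have "f \<in> F \<rightarrow> carrier G" "f i \<in> carrier G"
      using insert.prems H.a_subset by (auto simp: Pi_iff)
    ultimately show ?case using H.a_closed by (simp add: finsum_insert)
  qed simp_all
qed

text \<open>A trace element has a single summand for each homomorphism, so when two elements are
  added, their values under a common \<open>\<phi>\<close> have to be merged into one. Additivity of
  \<open>\<phi>\<close> does this by adding the arguments.\<close>

lemma (in cring) module_trace_subgroup:
  assumes "module R M"
  shows "additive_subgroup (module_trace R M) R"
proof -
  interpret M: module R M by fact
  let ?H = "module_homs R M (regular_module R)"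
  have closed: "\<phi> x \<in> carrier R" if "\<phi> \<in> ?H" "x \<in> carrier M" for \<phi> x
    using that by (auto simp: module_homs_def regular_module_def)
  have add: "\<phi> (x \<oplus>\<^bsub>M\<^esub> y) = \<phi> x \<oplus> \<phi> y"
    if "\<phi> \<in> ?H" "x \<in> carrier M" "y \<in> carrier M" for \<phi> x y
    using that by (simp add: module_homs_def regular_module_def)
  have smult: "\<phi> (a \<odot>\<^bsub>M\<^esub> x) = a \<otimes> \<phi> x"
    if "\<phi> \<in> ?H" "a \<in> carrier R" "x \<in> carrier M" for \<phi> a x
    using that by (simp add: module_homs_def regular_module_def)
  have hom_zero: "\<phi> \<zero>\<^bsub>M\<^esub> = \<zero>" if "\<phi> \<in> ?H" for \<phi>
    using smult[OF that, of \<zero> "\<zero>\<^bsub>M\<^esub>"] closed[OF that] by simp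
  have traceI: "(\<Oplus>\<phi>\<in>F. \<phi> (x \<phi>)) \<in> module_trace R M"
    if "finite F" "F \<subseteq> ?H" "x \<in> F \<rightarrow> carrier M" for F x
    using that unfolding module_trace_def by blast
  have sum_closed: "(\<lambda>\<phi>. \<phi> (x \<phi>)) \<in> F \<rightarrow> carrier R"
    if "F \<subseteq> ?H" "x \<in> F \<rightarrow> carrier M" for F x
    using that closed by blast
  show ?thesis
  proof (rule additive_subgroup.intro, rule add.subgroupI)
    show "module_trace R M \<subseteq> carrier R"
      unfolding module_trace_def using finsum_closed[OF sum_closed] by auto
    show "module_trace R M \<noteq> {}"
      using traceI[of "{}"] by blast
  next
    fix t assume "t \<in> module_trace R M"
    then obtain F x where F: "finite F" "F \<subseteq> ?H" "x \<in> F \<rightarrow> carrier M"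
      and t: "t = (\<Oplus>\<phi>\<in>F. \<phi> (x \<phi>))"
      unfolding module_trace_def by blast
    \<comment> \<open>Negation is written as multiplication by \<open>\<ominus> \<one>\<close>,
      since linearity lets this scalar pass into the arguments.\<close>
    have "\<ominus> t = \<ominus> \<one> \<otimes> t"
      using finsum_closed[OF sum_closed[OF F(2,3)]] by (simp add: t l_minus)
    also have "\<dots> = (\<Oplus>\<phi>\<in>F. \<ominus> \<one> \<otimes> \<phi> (x \<phi>))"
      unfolding t by (rule finsum_rdistr[OF F(1) _ sum_closed[OF F(2,3)]]) simp
    also have "\<dots> = (\<Oplus>\<phi>\<in>F. \<phi> ((\<ominus> \<one>) \<odot>\<^bsub>M\<^esub> x \<phi>))"
      by (rule finsum_cong') (use F closed smult in \<open>auto simp: Pi_iff subset_iff\<close>)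
    also have "\<dots> \<in> module_trace R M"
      by (rule traceI) (use F in auto)
    finally show "\<ominus> t \<in> module_trace R M" .
  next
    fix s t assume "s \<in> module_trace R M" "t \<in> module_trace R M"
    then obtain F x E y where F: "finite F" "F \<subseteq> ?H" "x \<in> F \<rightarrow> carrier M"
      and s: "s = (\<Oplus>\<phi>\<in>F. \<phi> (x \<phi>))"
      and E: "finite E" "E \<subseteq> ?H" "y \<in> E \<rightarrow> carrier M"
      and t: "t = (\<Oplus>\<phi>\<in>E. \<phi> (y \<phi>))"
      unfolding module_trace_def by blast
    \<comment> \<open>Each family is extended by the zero of \<open>M\<close> outside its own index
      set. Every \<open>\<phi>\<close> sends that zero to \<open>\<zero>\<close>, so both sums may
      be taken over \<open>F \<union> E\<close> and combined termwise.\<close>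
    define x' where "x' = (\<lambda>\<phi>. if \<phi> \<in> F then x \<phi> else \<zero>\<^bsub>M\<^esub>)"
    define y' where "y' = (\<lambda>\<phi>. if \<phi> \<in> E then y \<phi> else \<zero>\<^bsub>M\<^esub>)"
    have xy: "x' \<in> F \<union> E \<rightarrow> carrier M" "y' \<in> F \<union> E \<rightarrow> carrier M"
      using F E by (auto simp: x'_def y'_def)
    have FE: "finite (F \<union> E)" "F \<union> E \<subseteq> ?H" using F E by auto
    have "s = (\<Oplus>\<phi>\<in>F \<union> E. \<phi> (x' \<phi>))" unfolding s
      by (rule add.finprod_mono_neutral_cong_left)
        (use FE(1) E(2) sum_closed[OF FE(2) xy(1)] in \<open>auto simp: x'_def intro!: hom_zero\<close>)
    moreover have "t = (\<Oplus>\<phi>\<in>F \<union> E. \<phi> (y' \<phi>))" unfolding t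
      by (rule add.finprod_mono_neutral_cong_left)
        (use FE(1) F(2) sum_closed[OF FE(2) xy(2)] in \<open>auto simp: y'_def intro!: hom_zero\<close>)
    ultimately have "s \<oplus> t = (\<Oplus>\<phi>\<in>F \<union> E. \<phi> (x' \<phi>) \<oplus> \<phi> (y' \<phi>))"
      using finsum_addf[OF sum_closed[OF FE(2) xy(1)] sum_closed[OF FE(2) xy(2)]] by simp
    also have "\<dots> = (\<Oplus>\<phi>\<in>F \<union> E. \<phi> (x' \<phi> \<oplus>\<^bsub>M\<^esub> y' \<phi>))"
      by (rule finsum_cong') (use FE xy closed add in \<open>auto simp: Pi_iff subset_iff\<close>)
    also have "\<dots> \<in> module_trace R M"
      by (rule traceI[OF FE]) (use xy in auto)
    finally show "s \<oplus> t \<in> module_trace R M" .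
  qed
qed

lemma (in cring) module_hom_image_in_trace:
  assumes "\<phi> \<in> module_homs R M (regular_module R)" and "x \<in> carrier M"
  shows "\<phi> x \<in> module_trace R M"
proof -
  have "\<phi> x \<in> carrier R"
    using assms by (auto simp: module_homs_def regular_module_def)
  then have "(\<Oplus>\<psi>\<in>{\<phi>}. \<psi> x) = \<phi> x" by simp
  then show ?thesis
    unfolding module_trace_def
    using assms by (intro CollectI exI[of _ "{\<phi>}"] exI[of _ "\<lambda>_. x"]) simp
qed

section \<open>Products of graded components\<close>

text \<open>Preimages under multiplication by a fixed element allow membership of a product in
  \<open>H\<close> to be tested on one factor at a time.\<close>

lemma (in ring) additive_subgroup_preimage:
  assumes "additive_subgroup H R" and y: "y \<in> carrier R"
  shows "additive_subgroup {x \<in> carrier R. x \<otimes> y \<in> H} R"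
    and "additive_subgroup {x \<in> carrier R. y \<otimes> x \<in> H} R"
proof -
  interpret H: additive_subgroup H R by fact
  have neg: "\<ominus> h \<in> H" if "h \<in> H" for h
    using that H.a_inv_closed is_abelian_group by blast
  show "additive_subgroup {x \<in> carrier R. x \<otimes> y \<in> H} R"
    by (rule additive_subgroup.intro, rule add.subgroupI)
      (use y neg H.a_closed in \<open>auto simp: l_distr l_minus intro: exI[of _ \<zero>]\<close>)
  show "additive_subgroup {x \<in> carrier R. y \<otimes> x \<in> H} R"
    by (rule additive_subgroup.intro, rule add.subgroupI)
      (use y neg H.a_closed in \<open>auto simp: r_distr r_minus intro: exI[of _ \<zero>]\<close>)
qed

context graded_cring
begin

lemma component_closed: "x \<in> G i \<Longrightarrow> x \<in> carrier R"
  using additive_subgroup.a_subset[OF component_subgroup] by blast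

lemma component_in_homogeneous_sum:
  assumes "x \<in> H i" "x \<in> carrier R" "i \<in> I"
  shows "x \<in> homogeneous_sum R H I"
proof -
  have "(\<Oplus>k\<in>{i}. x) = x" using assms(2) by simp
  then show ?thesis
    unfolding homogeneous_sum_def
    using assms by (intro CollectI exI[of _ "{i}"] exI[of _ "\<lambda>_. x"]) simp
qed

text \<open>An element of \<open>G n\<close> has one decomposition concentrated in degree
  \<open>n\<close> and another with terms in the \<open>W i\<close>. Homogeneous decompositions are
  unique, so its only component is a member of \<open>W n\<close>. This turns a statement about
  generating \<open>R\<close> into one about each degree.\<close>

lemma component_subset_of_homogeneous_sum:
  assumes W: "\<And>i. W i \<subseteq> G i" "\<And>i. \<zero> \<in> W i"
    and sum: "homogeneous_sum R W UNIV = carrier R"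
  shows "G n \<subseteq> W n"
proof
  fix x assume x: "x \<in> G n"
  then have xc: "x \<in> carrier R" by (rule component_closed)
  obtain F c where F: "finite F" "c \<in> (\<Pi> i\<in>F. W i)" "x = (\<Oplus>i\<in>F. c i)"
    using xc unfolding sum[symmetric] homogeneous_sum_def by blast
  \<comment> \<open>Uniqueness in \<open>direct_sum\<close> concerns families indexed by all degrees
    and summed over their supports, so both decompositions are put in that form: \<open>c1\<close>
    is the one from \<open>W\<close>, and \<open>c2\<close> has \<open>x\<close> in degree
    \<open>n\<close> and \<open>\<zero>\<close> elsewhere.\<close>
  define c1 where "c1 = (\<lambda>i. if i \<in> F then c i else \<zero>)"
  define c2 where "c2 = (\<lambda>i. if i = n then x else \<zero>)"
  have c1W: "c1 i \<in> W i" for i using F(2) W(2) by (auto simp: c1_def Pi_iff)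
  have c1c: "c1 i \<in> carrier R" for i using c1W W(1) component_closed by blast
  have s1: "{i. c1 i \<noteq> \<zero>} \<subseteq> F" by (auto simp: c1_def)
  have "(\<Oplus>i\<in>F. c i) = (\<Oplus>i\<in>F. c1 i)"
    by (rule finsum_cong') (use c1c in \<open>auto simp: c1_def\<close>)
  also have "\<dots> = (\<Oplus>i\<in>{i. c1 i \<noteq> \<zero>}. c1 i)"
    by (rule add.finprod_mono_neutral_cong_right) (use F(1) s1 c1c in auto)
  finally have x1: "x = (\<Oplus>i\<in>{i. c1 i \<noteq> \<zero>}. c1 i)" using F(3) by simp
  have s2: "{i. c2 i \<noteq> \<zero>} \<subseteq> {n}" by (auto simp: c2_def)
  have "(\<Oplus>i\<in>{n}. c2 i) = (\<Oplus>i\<in>{i. c2 i \<noteq> \<zero>}. c2 i)"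
    by (rule add.finprod_mono_neutral_cong_right) (use s2 xc in \<open>auto simp: c2_def\<close>)
  then have x2: "x = (\<Oplus>i\<in>{i. c2 i \<noteq> \<zero>}. c2 i)" using xc by (simp add: c2_def)
  have c2G: "c2 i \<in> G i" for i using x W by (auto simp: c2_def)
  have "c1 = c2"
    using direct_sum[OF xc] x1 x2 c1W W(1) c2G
      finite_subset[OF s1 F(1)] finite_subset[OF s2] by (metis (no_types, lifting) finite.intros subsetD)
  then have "x = c1 n" by (simp add: c2_def)
  then show "x \<in> W n" using c1W by simp
qed

end

text \<open>The arbitrary subgroup \<open>H\<close> stands in for the span of the products.
  Generation in degree one enters here: the family \<open>W\<close> below contains
  \<open>G 0\<close> and \<open>G 1\<close> and is multiplicative, so its homogeneous sum is all of
  \<open>R\<close>, and comparing components gives \<open>G n \<subseteq> W n\<close>.\<close>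

lemma (in standard_graded_algebra) component_add_subset:
  assumes "additive_subgroup H R" and "\<And>y z. y \<in> G a \<Longrightarrow> z \<in> G b \<Longrightarrow> y \<otimes> z \<in> H"
  shows "G (a + b) \<subseteq> H"
proof -
  text \<open>\<open>W n\<close> is the part of \<open>G n\<close> that lies in the span of \<open>G a \<otimes> G b\<close> for all \<open>a + b = n\<close>.
    Unlike a single such span, it is multiplicative in \<open>n\<close>.\<close>
  define spans where "spans = (\<lambda>a b H. additive_subgroup H R \<and> (\<forall>y\<in>G a. \<forall>z\<in>G b. y \<otimes> z \<in> H))"
  define W where "W = (\<lambda>n. {x \<in> G n. \<forall>a b H. a + b = n \<longrightarrow> spans a b H \<longrightarrow> x \<in> H})"
  have spansI: "spans a b H"
    if "additive_subgroup H R" "\<And>y z. y \<in> G a \<Longrightarrow> z \<in> G b \<Longrightarrow> y \<otimes> z \<in> H" for a b H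
    using that by (simp add: spans_def)
  have spans_subgroup: "additive_subgroup H R" if "spans a b H" for a b H
    using that by (simp add: spans_def)
  have spans_prod: "y \<otimes> z \<in> H" if "spans a b H" "y \<in> G a" "z \<in> G b" for a b H y z
    using that by (simp add: spans_def)
  have WI: "x \<in> W n"
    if "x \<in> G n" "\<And>a b H. a + b = n \<Longrightarrow> spans a b H \<Longrightarrow> x \<in> H" for x n
    unfolding W_def by (intro CollectI conjI allI impI) (rule that(1), rule that(2))
  have WD: "x \<in> H" if "x \<in> W n" "spans a b H" "a + b = n" for x n a b H
    using that unfolding W_def by blast
  have WG: "W n \<subseteq> G n" for n by (simp add: W_def)
  have Wc: "x \<in> carrier R" if "x \<in> W n" for x n using that WG component_closed by blast
  have neg: "\<ominus> x \<in> H" if "additive_subgroup H R" "x \<in> H" for x H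
    using additive_subgroup.a_inv_closed[OF that(1)] that(2) is_abelian_group by simp
  have W: "additive_subgroup (W n) R" for n
  proof (rule additive_subgroup.intro, rule add.subgroupI)
    show "W n \<subseteq> carrier R" using Wc by blast
    have "\<zero> \<in> W n"
      by (rule WI) (auto dest: spans_subgroup intro: additive_subgroup.zero_closed component_subgroup)
    then show "W n \<noteq> {}" by blast
  next
    fix x assume x: "x \<in> W n"
    show "\<ominus> x \<in> W n"
    proof (rule WI)
      show "\<ominus> x \<in> G n" using neg[OF component_subgroup] x WG by blast
      show "\<ominus> x \<in> H" if "a + b = n" "spans a b H" for a b H
        by (rule neg[OF spans_subgroup[OF that(2)] WD[OF x that(2,1)]])
    qed
  next
    fix x y assume x: "x \<in> W n" and y: "y \<in> W n"
    show "x \<oplus> y \<in> W n"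
    proof (rule WI)
      show "x \<oplus> y \<in> G n"
        using additive_subgroup.a_closed[OF component_subgroup] x y WG by blast
      show "x \<oplus> y \<in> H" if "a + b = n" "spans a b H" for a b H
        by (rule additive_subgroup.a_closed[OF spans_subgroup[OF that(2)]
              WD[OF x that(2,1)] WD[OF y that(2,1)]])
    qed
  qed
  \<comment> \<open>A splitting \<open>a + b = m + n\<close> cuts inside one of the two factors:
    inside \<open>x\<close> if \<open>a \<le> m\<close>, inside \<open>y\<close> otherwise. Only
    that factor is split, and the other one is absorbed into the adjacent piece.\<close>
  have Wmult: "x \<otimes> y \<in> W (m + n)" if x: "x \<in> W m" and y: "y \<in> W n" for m n x y
  proof (rule WI)
    show "x \<otimes> y \<in> G (m + n)" using x y WG component_mult by blast
  next
    fix a b H assume ab: "a + b = m + n" and H: "spans a b H"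
    note prod = spans_prod[OF H] and preimage = additive_subgroup_preimage[OF spans_subgroup[OF H]]
    show "x \<otimes> y \<in> H"
    proof (cases "a \<le> m")
      case True
      then obtain e where e: "m = a + e" using le_Suc_ex by blast
      then have b: "b = e + n" using ab by simp
      \<comment> \<open>Regrouping \<open>u \<otimes> v \<otimes> y\<close> as
        \<open>u \<otimes> (v \<otimes> y)\<close> gives factors of degrees \<open>a\<close> and
        \<open>e + n = b\<close>, so the preimage of \<open>H\<close> under multiplication by
        \<open>y\<close> is an admissible test subgroup for \<open>x\<close>.\<close>
      have "spans a e {t \<in> carrier R. t \<otimes> y \<in> H}"
      proof (rule spansI[OF preimage(1)[OF Wc[OF y]]])
        fix u v assume u: "u \<in> G a" and v: "v \<in> G e"
        have "v \<otimes> y \<in> G b" unfolding b using v y WG component_mult by blast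
        then show "u \<otimes> v \<in> {t \<in> carrier R. t \<otimes> y \<in> H}"
          using prod[OF u] component_closed[OF u] component_closed[OF v] Wc[OF y]
          by (simp add: m_assoc)
      qed
      from WD[OF x this e[symmetric]] show ?thesis by simp
    next
      case False
      then have "m \<le> a" by simp
      then obtain e where e: "a = m + e" using le_Suc_ex by blast
      then have n: "e + b = n" using ab by simp
      \<comment> \<open>In the mirror case \<open>x\<close> joins the left piece, since
        \<open>x \<otimes> u\<close> has degree \<open>m + e = a\<close>.\<close>
      have "spans e b {t \<in> carrier R. x \<otimes> t \<in> H}"
      proof (rule spansI[OF preimage(2)[OF Wc[OF x]]])
        fix u v assume u: "u \<in> G e" and v: "v \<in> G b"
        have "x \<otimes> u \<in> G a" unfolding e using u x WG component_mult by blast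
        then show "u \<otimes> v \<in> {t \<in> carrier R. x \<otimes> t \<in> H}"
          using prod[OF _ v] component_closed[OF u] component_closed[OF v] Wc[OF x]
          by (simp add: m_assoc[symmetric])
      qed
      from WD[OF y this n] show ?thesis by simp
    qed
  qed
  \<comment> \<open>In degrees 0 and 1 every splitting has a part equal to 0, so
    \<open>\<one>\<close> can serve as one factor and \<open>x\<close> itself as the other.\<close>
  have one_component: "\<one> \<in> G 0" using component_zero by simp
  have W0: "x \<in> W 0" if x: "x \<in> G 0" for x
  proof (rule WI[OF x])
    fix a b H assume "a + b = (0::nat)" "spans a b H"
    then show "x \<in> H" using spans_prod[of 0 0 H x \<one>] x one_component component_closed[OF x] by simp
  qed
  have W1: "x \<in> W 1" if x: "x \<in> G 1" for x
  proof (rule WI[OF x])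
    fix a b H assume ab: "a + b = (1::nat)" and H: "spans a b H"
    from ab have "a = 1 \<and> b = 0 \<or> a = 0 \<and> b = 1" by auto
    then show "x \<in> H"
      using spans_prod[OF H, of x \<one>] spans_prod[OF H, of \<one> x] x one_component component_closed[OF x] by auto
  qed
  interpret S: additive_subgroup "homogeneous_sum R W UNIV" R
    by (rule homogeneous_sum_subgroup[OF W])
  \<comment> \<open>The homogeneous sum of \<open>W\<close> contains the generators and is closed
    under the ring operations.\<close>
  have gen: "x \<in> homogeneous_sum R W UNIV" if "x \<in> generate_ring R (K \<union> G 1)" for x
    using that
  proof (induction rule: generate_ring.induct)
    case one
    then show ?case
      using component_in_homogeneous_sum[of \<one> W 0] W0[OF one_component] by simp
  next
    case (incl h)
    then have "h \<in> W 0 \<or> h \<in> W 1" using W0 W1 component_zero by blast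
    then show ?case using component_in_homogeneous_sum Wc by blast
  next
    case (a_inv h)
    then show ?case using neg[OF S.additive_subgroup_axioms] by simp
  next
    case (eng_add h h')
    then show ?case using S.a_closed by simp
  next
    case (eng_mult h h')
    from eng_mult.IH show ?case by (intro homogeneous_sum_mult[of W W W]) (auto intro: W Wmult)
  qed
  have "G (a + b) \<subseteq> W (a + b)"
  proof (rule component_subset_of_homogeneous_sum[OF WG])
    show "\<zero> \<in> W i" for i using additive_subgroup.zero_closed[OF W] .
    show "homogeneous_sum R W UNIV = carrier R"
      using gen generated_in_degree_one S.a_subset by blast
  qed
  then show ?thesis using WD[OF _ spansI[OF assms]] by blast
qed

section \<open>The trace of a Veronese submodule\<close>

text \<open>Multiplication by \<open>a\<close> raises degree \<open>d * i + j\<close> to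
  \<open>Suc i * d\<close>, a multiple of \<open>d\<close>, so its values land in the Veronese ring.
  Linearity is distributivity together with commutativity.\<close>

lemma (in graded_cring) mult_hom_veronese:
  assumes a: "a \<in> G e" and e: "e + j = d"
  shows "(\<lambda>x. a \<otimes> x) \<in> module_homs (veronese_ring R G d) (veronese_submodule R G d j)
    (regular_module (veronese_ring R G d))"
proof -
  let ?S = "homogeneous_sum R (veronese_grading G d) UNIV"
  let ?M = "homogeneous_sum R (\<lambda>i. G (d * i + j)) UNIV"
  have ac: "a \<in> carrier R" using a by (rule component_closed)
  have S: "x \<in> carrier R" if "x \<in> ?S" for x
    using that additive_subgroup.a_subset[OF homogeneous_sum_subgroup, of "veronese_grading G d"]
      component_subgroup unfolding veronese_grading_def by blast
  have M: "x \<in> carrier R" if "x \<in> ?M" for x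
    using that additive_subgroup.a_subset[OF homogeneous_sum_subgroup, of "\<lambda>i. G (d * i + j)"]
      component_subgroup by blast
  have closed: "a \<otimes> x \<in> ?S" if x: "x \<in> ?M" for x
  proof -
    obtain F c where F: "finite F" "c \<in> (\<Pi> i\<in>F. G (d * i + j))" "x = (\<Oplus>i\<in>F. c i)"
      using x unfolding homogeneous_sum_def by blast
    have "a \<otimes> x = (\<Oplus>i\<in>F. a \<otimes> c i)"
      unfolding F(3) by (rule finsum_rdistr[OF F(1) ac]) (use F(2) component_closed in blast)
    also have "\<dots> \<in> ?S"
    proof (rule additive_subgroup_finsum_closed)
      show "additive_subgroup ?S R"
        by (rule homogeneous_sum_subgroup) (simp add: veronese_grading_def component_subgroup)
      show "(\<lambda>i. a \<otimes> c i) \<in> F \<rightarrow> ?S"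
      proof
        fix i assume "i \<in> F"
        then have "a \<otimes> c i \<in> G (e + (d * i + j))" using a F(2) component_mult by blast
        also have "e + (d * i + j) = Suc i * d" using e by (simp add: algebra_simps)
        finally show "a \<otimes> c i \<in> ?S"
          using component_in_homogeneous_sum[of _ "veronese_grading G d" "Suc i"] component_closed
          by (simp add: veronese_grading_def)
      qed
    qed
    finally show ?thesis .
  qed
  show ?thesis
    using closed ac S M
    by (auto simp: module_homs_def regular_module_def veronese_submodule_def veronese_ring_def
        r_distr m_lcomm)
qed

text \<open>The lowest product degree is \<open>(d - j) + j = d\<close>, which explains the shift to
  \<open>Suc i\<close>: the degrees reached are exactly the positive ones of the Veronese
  grading.\<close>

lemma (in standard_graded_algebra) veronese_component_in_trace:
  assumes "j \<le> d"
  shows "veronese_grading G d (Suc i) \<subseteq> module_trace (veronese_ring R G d) (veronese_submodule R G d j)"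
proof -
  let ?A = "veronese_ring R G d" and ?M = "veronese_submodule R G d j"
  let ?S = "homogeneous_sum R (veronese_grading G d) UNIV"
  interpret A: cring ?A by (rule veronese_ring_cring)
  have "additive_subgroup (module_trace ?A ?M) ?A"
    by (rule A.module_trace_subgroup[OF veronese_submodule_module])
  \<comment> \<open>The trace is known to be a subgroup of the Veronese ring, while
    \<open>component_add_subset\<close> asks for a subgroup of \<open>R\<close>. The two rings
    differ only in their carriers, so a subgroup of the smaller one is a subgroup of the
    larger.\<close>
  moreover have "add_monoid ?A = (add_monoid R)\<lparr>carrier := ?S\<rparr>"
    by (simp add: veronese_ring_def)
  moreover have "subgroup ?S (add_monoid R)"
    using homogeneous_sum_subgroup[of "veronese_grading G d"] component_subgroup
    by (simp add: veronese_grading_def additive_subgroup_def)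
  ultimately have T: "additive_subgroup (module_trace ?A ?M) R"
    using add.incl_subgroup by (simp add: additive_subgroup_def)
  have "G ((d - j) + (d * i + j)) \<subseteq> module_trace ?A ?M"
  proof (rule component_add_subset[OF T])
    fix y z assume y: "y \<in> G (d - j)" and z: "z \<in> G (d * i + j)"
    have "z \<in> carrier ?M"
      using component_in_homogeneous_sum[of z "\<lambda>i. G (d * i + j)" i] z component_closed
      by (simp add: veronese_submodule_def)
    then show "y \<otimes> z \<in> module_trace ?A ?M"
      using A.module_hom_image_in_trace[OF mult_hom_veronese[OF y]] assms by simp
  qed
  moreover have "(d - j) + (d * i + j) = Suc i * d" using assms by (simp add: algebra_simps)
  ultimately show ?thesis by (simp add: veronese_grading_def)
qed

theorem theorem4p6:
  fixes R :: "('a, 'm) ring_scheme" and K :: "'a set" and G :: "nat \<Rightarrow> 'a set" and d j :: nat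
  assumes "standard_graded_algebra K R G"
    and "depth R G > 0"
    and "d > 0"
    and "j \<le> d - 1"
  shows "graded_maximal_ideal (veronese_ring R G d) (veronese_grading G d)
    \<subseteq> module_trace (veronese_ring R G d) (veronese_submodule R G d j)"
proof
  let ?A = "veronese_ring R G d" and ?M = "veronese_submodule R G d j"
  interpret standard_graded_algebra K R G by fact
  interpret A: cring ?A by (rule veronese_ring_cring)
  have T: "additive_subgroup (module_trace ?A ?M) ?A"
    by (rule A.module_trace_subgroup[OF veronese_submodule_module])
  have jd: "j \<le> d" using assms(4) by linarith
  fix x assume "x \<in> graded_maximal_ideal ?A (veronese_grading G d)"
  then obtain F c where F: "F \<subseteq> {0<..}" "c \<in> (\<Pi> i\<in>F. veronese_grading G d i)"
    and x: "x = (\<Oplus>\<^bsub>?A\<^esub>i\<in>F. c i)"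
    unfolding graded_maximal_ideal_def homogeneous_sum_def by blast
  show "x \<in> module_trace ?A ?M"
    unfolding x
  \<comment> \<open>The trace is closed under sums, so it suffices to treat the homogeneous
    terms.\<close>
  proof (rule A.additive_subgroup_finsum_closed[OF T])
    show "c \<in> F \<rightarrow> module_trace ?A ?M"
    proof
      fix i assume i: "i \<in> F"
      \<comment> \<open>Degrees in the graded maximal ideal are positive, hence successors.\<close>
      then obtain k where "i = Suc k" using F(1) gr0_implies_Suc by blast
      then show "c i \<in> module_trace ?A ?M"
        using veronese_component_in_trace[OF jd, of k] F(2) i by blast
    qed
  qed
qed

end
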